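(* Let $n\geq 1$, let $A,B\subseteq X_n=\{1,\ldots,n\}$, let $\varepsilon_1,\varepsilon_2\in\{1,-1\}$, and denote by $\mathcal{O}_n(\varepsilon_1\gamma_A,\varepsilon_2\gamma_B)$ the orbit of $(\varepsilon_1\gamma_A,\varepsilon_2\gamma_B)$ under the action of $\mathbb{CL}(n)$ by (simultaneous) conjugation on $\mathbb{CL}(n)\times\mathbb{CL}(n)$. Then: (a) $\mathcal{O}_n(\varepsilon_1\gamma_\varnothing,\varepsilon_2\gamma_\varnothing)=\{(\varepsilon_1\gamma_\varnothing,\varepsilon_2\gamma_\varnothing)\}$. (b) If $A\neq B$ and $A,B\neq\varnothing,X_n$, then $$\mathcal{O}_n(\varepsilon_1\gamma_A,\varepsilon_2\gamma_B)=\{(\gamma_A,\gamma_B),(-\gamma_A,-\gamma_B),(-\gamma_A,\gamma_B),(\gamma_A,-\gamma_B)\},$$ unless $n$ is odd and $X_n$ is the disjoint union of $A$ and $B$, in which case $$\mathcal{O}_n(\varepsilon_1\gamma_A,\varepsilon_2\gamma_B)=\{(\varepsilon_1\gamma_A,\varepsilon_2\gamma_B),(-\varepsilon_1\gamma_A,-\varepsilon_2\gamma_B)\}.$$ (c) If $A\neq\varnothing$, then $$\mathcal{O}_n(\varepsilon_1\gamma_\varnothing,\varepsilon_2\gamma_A)=\{(\varepsilon_1\gamma_\varnothing,\varepsilon_2\gamma_A),(\varepsilon_1\gamma_\varnothing,-\varepsilon_2\gamma_A)\},$$ unless $n$ is odd and $A=X_n$, in which case $\mathcal{O}_n(\varepsilon_1\gamma_\varnothing,\varepsilon_2\gamma_{X_n})=\{(\varepsilon_1\gamma_\varnothing,\varepsilon_2\gamma_{X_n})\}$.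 The analogous result holds for $\mathcal{O}_n(\varepsilon_1\gamma_A,\varepsilon_2\gamma_\varnothing)$: it equals $\{(\varepsilon_1\gamma_A,\varepsilon_2\gamma_\varnothing),(-\varepsilon_1\gamma_A,\varepsilon_2\gamma_\varnothing)\}$ unless $n$ is odd and $A=X_n$, in which case it equals $\{(\varepsilon_1\gamma_{X_n},\varepsilon_2\gamma_\varnothing)\}$. (d) If $A\neq\varnothing$, then $$\mathcal{O}_n(\varepsilon_1\gamma_A,\varepsilon_2\gamma_A)=\{(\varepsilon_1\gamma_A,\varepsilon_2\gamma_A),(-\varepsilon_1\gamma_A,-\varepsilon_2\gamma_A)\},$$ unless $n$ is odd and $A=X_n$, in which case $\mathcal{O}_n(\varepsilon_1\gamma_{X_n},\varepsilon_2\gamma_{X_n})=\{(\varepsilon_1\gamma_{X_n},\varepsilon_2\gamma_{X_n})\}$.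
   Context: The Clifford group of degree $n$ is the group $\mathbb{CL}(n)=\{\pm\gamma_A : A\subseteq X_n\}$ of order $2^{n+1}$ (the elements $\varepsilon\gamma_A$, $\varepsilon=\pm1$, $A\subseteq X_n$, being pairwise distinct formal symbols), with multiplication $\varepsilon_1\gamma_A\cdot\varepsilon_2\gamma_B=\varepsilon_1\varepsilon_2(-1)^{\xi(A,B)}\gamma_{A\triangle B}$, where $A\triangle B$ is the symmetric difference and $\xi(A,B)$ is the number of pairs $(a,b)\in A\times B$ with $a>b$. The identity is $\gamma_\varnothing$. The action of $\mathbb{CL}(n)$ by conjugation on $\mathbb{CL}(n)\times\mathbb{CL}(n)$ is $g\cdot(x,y)=(gxg^{-1},gyg^{-1})$. *)

theory Defs
  imports "HOL-Algebra.Group_Action"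
begin

definition inversions :: "nat set \<Rightarrow> nat set \<Rightarrow> nat"
  where "inversions A B = card {(a, b) \<in> A \<times> B. a > b}"

text \<open>The formal symbol \<open>\<epsilon>\<gamma>\<^sub>A\<close> is the pair \<open>(\<epsilon>, A)\<close>, so \<open>\<gamma>\<^sub>A\<close> is \<open>(1, A)\<close> and
  \<open>-\<epsilon>\<gamma>\<^sub>A\<close> is \<open>(-\<epsilon>, A)\<close>.\<close>

definition clifford_group :: "nat \<Rightarrow> (int \<times> nat set) monoid"
  where "clifford_group n =
    \<lparr>carrier = {1, -1} \<times> Pow {1..n},
     mult = (\<lambda>(\<epsilon>\<^sub>1, A) (\<epsilon>\<^sub>2, B). (\<epsilon>\<^sub>1 * \<epsilon>\<^sub>2 * (-1) ^ inversions A B, sym_diff A B)),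
     one = (1, {})\<rparr>"

definition conj_pair_action :: "('a, 'b) monoid_scheme \<Rightarrow> 'a \<Rightarrow> 'a \<times> 'a \<Rightarrow> 'a \<times> 'a"
  where "conj_pair_action G = (\<lambda>g. \<lambda>(x, y) \<in> carrier G \<times> carrier G.
    (g \<otimes>\<^bsub>G\<^esub> x \<otimes>\<^bsub>G\<^esub> inv\<^bsub>G\<^esub> g, g \<otimes>\<^bsub>G\<^esub> y \<otimes>\<^bsub>G\<^esub> inv\<^bsub>G\<^esub> g))"

definition clifford_orbit :: "nat \<Rightarrow> int \<times> nat set \<Rightarrow> int \<times> nat set \<Rightarrow>
    ((int \<times> nat set) \<times> (int \<times> nat set)) set"
  where "clifford_orbit n x y =
    orbit (clifford_group n) (conj_pair_action (clifford_group n)) (x, y)"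

lemma minus_one_power_card_sym_diff:
  assumes "finite S" "finite T"
  shows "(-1 :: int) ^ card (sym_diff S T) = (-1) ^ card S * (-1) ^ card T"
proof -
  have 1: "card (sym_diff S T) = card (S - T) + card (T - S)"
    using assms by (intro card_Un_disjoint) auto
  have 2: "card S = card (S - T) + card (S \<inter> T)"
    using assms by (metis card_Diff_subset_Int card_Int_Diff add.commute)
  have 3: "card T = card (T - S) + card (S \<inter> T)"
    using assms by (metis card_Int_Diff add.commute Int_commute)
  show ?thesis
    unfolding 1 2 3 by (simp add: power_add flip: power2_eq_square power_mult)
qed

lemma minus_one_power_inversions_sym_diff:
  assumes "finite A" "finite B" "finite C"
  shows "(-1 :: int) ^ inversions (sym_diff A B) C =
           (-1) ^ inversions A C * (-1) ^ inversions B C"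
    and "(-1 :: int) ^ inversions C (sym_diff A B) =
           (-1) ^ inversions C A * (-1) ^ inversions C B"
proof -
  have fin: "finite {(a, b) \<in> X \<times> Y. a > b}" if "finite X" "finite Y" for X Y :: "nat set"
    by (rule finite_subset[of _ "X \<times> Y"]) (use that in auto)
  have 1: "{(a, b) \<in> sym_diff A B \<times> C. a > b} =
    sym_diff {(a, b) \<in> A \<times> C. a > b} {(a, b) \<in> B \<times> C. a > b}" by auto
  have 2: "{(a, b) \<in> C \<times> sym_diff A B. a > b} =
    sym_diff {(a, b) \<in> C \<times> A. a > b} {(a, b) \<in> C \<times> B. a > b}" by auto
  show "(-1 :: int) ^ inversions (sym_diff A B) C =
          (-1) ^ inversions A C * (-1) ^ inversions B C"
    unfolding inversions_def 1 by (intro minus_one_power_card_sym_diff fin assms)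
  show "(-1 :: int) ^ inversions C (sym_diff A B) =
          (-1) ^ inversions C A * (-1) ^ inversions C B"
    unfolding inversions_def 2 by (intro minus_one_power_card_sym_diff fin assms)
qed

lemma group_clifford_group: "group (clifford_group n)"
proof (rule groupI)
  have sign: "(-1 :: int) ^ k = 1 \<or> (-1 :: int) ^ k = -1" for k
    by (cases "even k") simp_all
  fix x y z
  assume x: "x \<in> carrier (clifford_group n)" and y: "y \<in> carrier (clifford_group n)"
    and z: "z \<in> carrier (clifford_group n)"
  show "x \<otimes>\<^bsub>clifford_group n\<^esub> y \<in> carrier (clifford_group n)"
    using x y sign[of "inversions (snd x) (snd y)"] by (auto simp: clifford_group_def)
  obtain a A b B c C where xyz: "x = (a, A)" "y = (b, B)" "z = (c, C)"
    by (metis surj_pair)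
  have fin: "finite A" "finite B" "finite C"
    using x y z by (auto simp: clifford_group_def xyz intro: finite_subset)
  have "sym_diff (sym_diff A B) C = sym_diff A (sym_diff B C)" by auto
  then show "x \<otimes>\<^bsub>clifford_group n\<^esub> y \<otimes>\<^bsub>clifford_group n\<^esub> z =
      x \<otimes>\<^bsub>clifford_group n\<^esub> (y \<otimes>\<^bsub>clifford_group n\<^esub> z)"
    by (simp add: clifford_group_def xyz minus_one_power_inversions_sym_diff fin)
next
  show "\<one>\<^bsub>clifford_group n\<^esub> \<in> carrier (clifford_group n)"
    by (simp add: clifford_group_def)
next
  fix x assume "x \<in> carrier (clifford_group n)"
  then show "\<one>\<^bsub>clifford_group n\<^esub> \<otimes>\<^bsub>clifford_group n\<^esub> x = x"
    by (auto simp: clifford_group_def inversions_def)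
next
  fix x assume x: "x \<in> carrier (clifford_group n)"
  obtain a A where xA: "x = (a, A)" by (metis surj_pair)
  let ?y = "(a * (-1) ^ inversions A A, A)"
  have sq: "(-1 :: int) ^ k * (-1) ^ k = 1" for k
    by (simp flip: power_add)
  have "?y \<in> carrier (clifford_group n)"
    using x by (cases "even (inversions A A)") (auto simp: clifford_group_def xA)
  moreover have "?y \<otimes>\<^bsub>clifford_group n\<^esub> x = \<one>\<^bsub>clifford_group n\<^esub>"
    using x sq[of "inversions A A"] by (auto simp: clifford_group_def xA)
  ultimately show "\<exists>y \<in> carrier (clifford_group n).
      y \<otimes>\<^bsub>clifford_group n\<^esub> x = \<one>\<^bsub>clifford_group n\<^esub>" by blast
qed

lemma order_clifford_group: "order (clifford_group n) = 2 ^ (n + 1)"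
  by (simp add: order_def clifford_group_def card_cartesian_product card_Pow)

lemma (in group) group_action_conj_pair:
  "group_action G (carrier G \<times> carrier G) (conj_pair_action G)"
proof -
  let ?E = "carrier G \<times> carrier G"
  let ?\<phi> = "conj_pair_action G"
  have app: "?\<phi> g (x, y) = (g \<otimes> x \<otimes> inv g, g \<otimes> y \<otimes> inv g)"
    if "x \<in> carrier G" "y \<in> carrier G" for g x y
    using that by (simp add: conj_pair_action_def)
  have cancel: "inv g \<otimes> (g \<otimes> x \<otimes> inv g) \<otimes> g = x" "g \<otimes> (inv g \<otimes> x \<otimes> g) \<otimes> inv g = x"
    if "g \<in> carrier G" "x \<in> carrier G" for g x
    using that by (simp_all add: m_assoc) (simp_all add: inv_solve_left flip: m_assoc)
  have bij: "?\<phi> g \<in> Bij ?E" if g: "g \<in> carrier G" for g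
  proof -
    have "bij_betw (?\<phi> g) ?E ?E"
      by (rule bij_betw_byWitness[where f' = "?\<phi> (inv g)"]) (auto simp: app g cancel)
    then show ?thesis by (simp add: Bij_def conj_pair_action_def)
  qed
  have hom: "?\<phi> (g \<otimes> h) = compose ?E (?\<phi> g) (?\<phi> h)"
    if g: "g \<in> carrier G" and h: "h \<in> carrier G" for g h
  proof (rule extensionalityI[of _ ?E])
    show "?\<phi> (g \<otimes> h) \<in> extensional ?E" by (simp add: conj_pair_action_def)
    show "compose ?E (?\<phi> g) (?\<phi> h) \<in> extensional ?E" by simp
    fix p assume "p \<in> ?E"
    then show "?\<phi> (g \<otimes> h) p = compose ?E (?\<phi> g) (?\<phi> h) p"
      by (auto simp: app g h compose_def inv_mult_group m_assoc)
  qed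
  have "?\<phi> \<in> hom G (BijGroup ?E)"
    by (auto simp: hom_def BijGroup_def bij hom)
  then show ?thesis
    unfolding group_action_def group_hom_def group_hom_axioms_def
    using group_BijGroup is_group by blast
qed

end

theory Submission
  imports Defs
begin

text \<open>
  Moving \<open>\<gamma>\<^sub>C\<close> past \<open>\<gamma>\<^sub>A\<close> costs a sign, the \<^emph>\<open>commutation sign\<close> of \<open>C\<close> and \<open>A\<close>, so conjugation
  by \<open>\<plusminus>\<gamma>\<^sub>C\<close> multiplies \<open>\<epsilon>\<gamma>\<^sub>A\<close> by that sign and keeps the index set \<open>A\<close>. Hence the orbit of
  \<open>(\<epsilon>\<^sub>1\<gamma>\<^sub>A, \<epsilon>\<^sub>2\<gamma>\<^sub>B)\<close> is governed by the pairs of signs that \<open>(A, B)\<close> receives as \<open>C\<close> runs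
  through the subsets of \<open>X\<^sub>n\<close> (lemma \<open>clifford_orbit_eq\<close>).

  The commutation sign is multiplicative for symmetric difference in both arguments, so each
  \<open>A\<close> gives a character of the elementary abelian 2-group \<open>Pow X\<^sub>n\<close>. By counting, its value at \<open>C\<close>
  is \<open>(-1) ^ (|C| |A| - |C \<inter> A|)\<close>, so it is trivial for \<open>A = \<emptyset>\<close>, and for
  \<open>A = X\<^sub>n\<close> when \<open>n\<close> is odd; for every other \<open>A\<close> it takes the value \<open>-1\<close> at some singleton
  (lemma \<open>range_comm_sign\<close>). The sets with trivial character index the centre of the group. This settles
  every orbit in which only one character occurs.

  When \<open>A\<close> and \<open>B\<close> both occur, the pairs of signs form a subgroup of \<open>{1, -1} \<times> {1, -1}\<close>. It is
  everything unless one of the characters of \<open>A\<close>, \<open>B\<close> and \<open>sym_diff A B\<close> (the product of the first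
  two) is trivial. If \<open>A \<noteq> B\<close> and neither is empty or \<open>X\<^sub>n\<close>, this can only happen through
  \<open>sym_diff A B = X\<^sub>n\<close> with \<open>n\<close> odd, that is, for \<open>n\<close> odd and \<open>X\<^sub>n\<close> the disjoint union of \<open>A\<close>
  and \<open>B\<close>; then the characters of \<open>A\<close> and \<open>B\<close> agree.
\<close>

section \<open>Commutation signs\<close>

definition comm_sign :: "nat set \<Rightarrow> nat set \<Rightarrow> int"
  where "comm_sign C A = (-1) ^ inversions C A * (-1) ^ inversions A C"

lemma comm_sign_cases: "comm_sign C A = 1 \<or> comm_sign C A = -1"
  by (cases "even (inversions C A)"; cases "even (inversions A C)") (auto simp: comm_sign_def)

lemma comm_sign_empty [simp]: "comm_sign {} A = 1" "comm_sign C {} = 1"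
  by (simp_all add: comm_sign_def inversions_def)

lemma comm_sign_sym_diff_left:
  assumes "finite C" "finite D" "finite A"
  shows "comm_sign (sym_diff C D) A = comm_sign C A * comm_sign D A"
  using assms by (simp add: comm_sign_def minus_one_power_inversions_sym_diff)

lemma comm_sign_sym_diff_right:
  assumes "finite C" "finite A" "finite B"
  shows "comm_sign C (sym_diff A B) = comm_sign C A * comm_sign C B"
  using assms by (simp add: comm_sign_def minus_one_power_inversions_sym_diff)

text \<open>Every pair in \<open>C \<times> A\<close> is an inversion of \<open>(C, A)\<close>, or swaps to one of \<open>(A, C)\<close>, or lies on
  the diagonal.\<close>

lemma inversions_add_swap:
  assumes "finite C" "finite A"
  shows "inversions C A + inversions A C + card (C \<inter> A) = card C * card A"
proof -
  let ?P = "{(c, a) \<in> C \<times> A. c > a}" and ?Q = "{(c, a) \<in> C \<times> A. c < a}"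
  let ?R = "{(c, a) \<in> C \<times> A. c = a}"
  have fin: "finite ?P" "finite ?Q" "finite ?R"
    by (rule finite_subset[of _ "C \<times> A"], use assms in auto)+
  have "?Q = prod.swap ` {(a, c) \<in> A \<times> C. a > c}"
    by auto
  then have Q: "card ?Q = inversions A C"
    by (simp add: inversions_def card_image)
  have "?R = (\<lambda>x. (x, x)) ` (C \<inter> A)"
    by auto
  then have R: "card ?R = card (C \<inter> A)"
    by (simp add: card_image inj_on_def)
  have "C \<times> A = (?P \<union> ?Q) \<union> ?R"
    by auto
  then have "card (C \<times> A) = card ((?P \<union> ?Q) \<union> ?R)"
    by (rule arg_cong)
  also have "\<dots> = card (?P \<union> ?Q) + card ?R"
    using fin by (intro card_Un_disjoint) auto
  also have "card (?P \<union> ?Q) = card ?P + card ?Q"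
    using fin by (intro card_Un_disjoint) auto
  finally show ?thesis
    unfolding Q R by (simp add: inversions_def card_cartesian_product)
qed

lemma comm_sign_eq:
  assumes "finite C" "finite A"
  shows "comm_sign C A = (-1) ^ (card C * card A + card (C \<inter> A))"
proof -
  have "comm_sign C A = (-1) ^ (inversions C A + inversions A C + 2 * card (C \<inter> A))"
    by (simp add: comm_sign_def power_add)
  then show ?thesis
    by (simp add: mult_2 add.assoc flip: inversions_add_swap[OF assms])
qed

text \<open>A non-central \<open>\<gamma>\<^sub>A\<close> anticommutes with a single generator: one inside \<open>A\<close> if \<open>|A|\<close> is even, one
  outside \<open>A\<close> if \<open>|A|\<close> is odd. The excluded index sets are those for which this choice fails.\<close>

lemma comm_sign_nontrivial:
  assumes A: "A \<subseteq> {1..n}" "A \<noteq> {}" and nc: "\<not> (odd n \<and> A = {1..n})"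
  shows "\<exists>C \<subseteq> {1..n}. comm_sign C A = -1"
proof -
  have fin: "finite A"
    using A(1) finite_subset by blast
  show ?thesis
  proof (cases "even (card A)")
    case True
    obtain x where "x \<in> A"
      using A(2) by blast
    then have "{x} \<subseteq> {1..n}" "comm_sign {x} A = -1"
      using A(1) True fin by (auto simp: comm_sign_eq)
    then show ?thesis by blast
  next
    case False
    then have "A \<noteq> {1..n}"
      using nc by auto
    then obtain x where "x \<in> {1..n}" "x \<notin> A"
      using A(1) by blast
    then have "{x} \<subseteq> {1..n}" "comm_sign {x} A = -1"
      using False fin by (auto simp: comm_sign_eq)
    then show ?thesis by blast
  qed
qed

lemma comm_sign_full:
  assumes "odd n" "C \<subseteq> {1..n}"
  shows "comm_sign C {1..n} = 1"
proof -
  have "C \<inter> {1..n} = C" and "finite C"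
    using assms(2) finite_subset by auto
  then show ?thesis
    using assms(1) by (simp add: comm_sign_eq)
qed

lemma range_comm_sign:
  assumes "A \<subseteq> {1..n}"
  shows "(\<lambda>C. comm_sign C A) ` Pow {1..n} =
           (if A = {} \<or> odd n \<and> A = {1..n} then {1} else {1, -1})"
proof (cases "A = {} \<or> odd n \<and> A = {1..n}")
  case True
  then have "comm_sign C A = 1" if "C \<in> Pow {1..n}" for C
    using that comm_sign_full by auto
  then have "(\<lambda>C. comm_sign C A) ` Pow {1..n} = {1}"
    by force
  then show ?thesis
    using True by simp
next
  case False
  then obtain C where "C \<subseteq> {1..n}" "comm_sign C A = -1"
    using comm_sign_nontrivial[OF assms] by blast
  then have "-1 \<in> (\<lambda>C. comm_sign C A) ` Pow {1..n}"
    by (intro rev_image_eqI[of C]) simp_all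
  moreover have "1 \<in> (\<lambda>C. comm_sign C A) ` Pow {1..n}"
    by (rule rev_image_eqI[of "{}"]) simp_all
  moreover have "(\<lambda>C. comm_sign C A) ` Pow {1..n} \<subseteq> {1, -1}"
    using comm_sign_cases by blast
  ultimately have "(\<lambda>C. comm_sign C A) ` Pow {1..n} = {1, -1}"
    by blast
  then show ?thesis
    unfolding if_not_P[OF False] .
qed

text \<open>A proper subgroup of \<open>{1, -1} \<times> {1, -1}\<close> has at most one element besides the identity,
  and that element is sent to 1 by the first coordinate, by the second, or by their product. These
  three maps give the characters of \<open>A\<close>, \<open>B\<close> and \<open>sym_diff A B\<close>, so if none of them is trivial, all
  pairs of signs occur.\<close>

lemma range_comm_sign_pair:
  assumes A: "A \<subseteq> {1..n}" "A \<noteq> {}" "\<not> (odd n \<and> A = {1..n})"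
    and B: "B \<subseteq> {1..n}" "B \<noteq> {}" "\<not> (odd n \<and> B = {1..n})"
    and AB: "A \<noteq> B" "\<not> (odd n \<and> sym_diff A B = {1..n})"
  shows "(\<lambda>C. (comm_sign C A, comm_sign C B)) ` Pow {1..n} = {1, -1} \<times> {1, -1}"
proof -
  define R where "R = (\<lambda>C. (comm_sign C A, comm_sign C B)) ` Pow {1..n}"
  have fin: "finite S" if "S \<subseteq> {1..n}" for S
    using that finite_subset by blast
  have closed: "(s * s', t * t') \<in> R" if st: "(s, t) \<in> R" "(s', t') \<in> R" for s t s' t'
  proof -
    obtain C D where CD: "C \<subseteq> {1..n}" "D \<subseteq> {1..n}"
      and eq: "s = comm_sign C A" "t = comm_sign C B" "s' = comm_sign D A" "t' = comm_sign D B"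
      using st unfolding R_def by auto
    have "sym_diff C D \<in> Pow {1..n}"
      using CD by auto
    then show ?thesis
      unfolding eq R_def
      by (rule rev_image_eqI) (simp only: comm_sign_sym_diff_left fin CD A(1) B(1))
  qed
  have mem: "(comm_sign C A, comm_sign C B) \<in> R" if "C \<subseteq> {1..n}" for C
    using that unfolding R_def by blast
  have one: "(1, 1) \<in> R"
    using mem[of "{}"] by simp
  obtain C1 where "C1 \<subseteq> {1..n}" "comm_sign C1 A = -1"
    using comm_sign_nontrivial[OF A] by blast
  then obtain t where t: "(-1, t) \<in> R" "t = 1 \<or> t = -1"
    using mem[of C1] comm_sign_cases[of C1 B] by metis
  obtain C2 where "C2 \<subseteq> {1..n}" "comm_sign C2 B = -1"
    using comm_sign_nontrivial[OF B] by blast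
  then obtain s where s: "(s, -1) \<in> R" "s = 1 \<or> s = -1"
    using mem[of C2] comm_sign_cases[of C2 A] by metis
  have "sym_diff A B \<subseteq> {1..n}" "sym_diff A B \<noteq> {}"
    using A(1) B(1) AB(1) by auto
  then obtain C3 where C3: "C3 \<subseteq> {1..n}" "comm_sign C3 (sym_diff A B) = -1"
    using comm_sign_nontrivial[OF _ _ AB(2)] by blast
  then have "comm_sign C3 A * comm_sign C3 B = -1"
    using comm_sign_sym_diff_right[of C3 A B] fin A(1) B(1) by simp
  then have "(1, -1) \<in> R \<or> (-1, 1) \<in> R"
    using mem[OF C3(1)] comm_sign_cases[of C3 A] comm_sign_cases[of C3 B] by auto
  \<comment> \<open>Multiplying the element found by \<open>(-1, t)\<close> or \<open>(s, -1)\<close> gives the other one, unless that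
    pair already is the other one.\<close>
  then have "(1, -1) \<in> R \<and> (-1, 1) \<in> R"
    using t s closed[of 1 "-1" "-1" t] closed[of "-1" 1 s "-1"] by auto
  moreover from this have "(-1, -1) \<in> R"
    using closed[of 1 "-1" "-1" 1] by simp
  moreover have "R \<subseteq> {1, -1} \<times> {1, -1}"
    unfolding R_def using comm_sign_cases by blast
  ultimately show ?thesis
    unfolding R_def[symmetric] using one by auto
qed

section \<open>Conjugation and orbits\<close>

lemma clifford_conjugate:
  assumes "\<delta> \<in> {1, -1}" "C \<subseteq> {1..n}" "\<epsilon> \<in> {1, -1}" "A \<subseteq> {1..n}"
  shows "(\<delta>, C) \<otimes>\<^bsub>clifford_group n\<^esub> (\<epsilon>, A) \<otimes>\<^bsub>clifford_group n\<^esub> inv\<^bsub>clifford_group n\<^esub> (\<delta>, C)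
           = (comm_sign C A * \<epsilon>, A)"
proof -
  let ?G = "clifford_group n"
  interpret group ?G by (rule group_clifford_group)
  have carr: "(\<delta>, C) \<in> carrier ?G" "(\<epsilon>, A) \<in> carrier ?G" "(comm_sign C A * \<epsilon>, A) \<in> carrier ?G"
    using assms comm_sign_cases[of C A] by (auto simp: clifford_group_def)
  have sq: "(-1 :: int) ^ k * (-1) ^ k = 1" for k
    by (simp flip: power_add)
  have "sym_diff C A = sym_diff A C"
    by auto
  then have "(\<delta>, C) \<otimes>\<^bsub>?G\<^esub> (\<epsilon>, A) = (comm_sign C A * \<epsilon>, A) \<otimes>\<^bsub>?G\<^esub> (\<delta>, C)"
    using sq[of "inversions A C"] by (simp add: clifford_group_def comm_sign_def algebra_simps)
  then show ?thesis
    using carr by (metis inv_solve_right m_closed)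
qed

lemma clifford_orbit_eq:
  assumes "\<epsilon>\<^sub>1 \<in> {1, -1}" "A \<subseteq> {1..n}" "\<epsilon>\<^sub>2 \<in> {1, -1}" "B \<subseteq> {1..n}"
  shows "clifford_orbit n (\<epsilon>\<^sub>1, A) (\<epsilon>\<^sub>2, B) =
           (\<lambda>(s, t). ((s * \<epsilon>\<^sub>1, A), (t * \<epsilon>\<^sub>2, B))) `
             (\<lambda>C. (comm_sign C A, comm_sign C B)) ` Pow {1..n}"
proof -
  let ?G = "clifford_group n"
  have car: "carrier ?G = {1, -1} \<times> Pow {1..n}"
    by (simp add: clifford_group_def)
  have act: "conj_pair_action ?G (\<delta>, C) ((\<epsilon>\<^sub>1, A), (\<epsilon>\<^sub>2, B)) =
      ((comm_sign C A * \<epsilon>\<^sub>1, A), (comm_sign C B * \<epsilon>\<^sub>2, B))"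
    if "\<delta> \<in> {1, -1}" "C \<subseteq> {1..n}" for \<delta> C
  proof -
    have "(\<epsilon>\<^sub>1, A) \<in> carrier ?G" "(\<epsilon>\<^sub>2, B) \<in> carrier ?G"
      using assms by (auto simp: car)
    then show ?thesis
      using that assms by (simp add: conj_pair_action_def clifford_conjugate del: insert_iff)
  qed
  have "clifford_orbit n (\<epsilon>\<^sub>1, A) (\<epsilon>\<^sub>2, B) =
      (\<lambda>g. conj_pair_action ?G g ((\<epsilon>\<^sub>1, A), (\<epsilon>\<^sub>2, B))) ` ({1, -1} \<times> Pow {1..n})"
    unfolding clifford_orbit_def orbit_def car by auto
  also have "\<dots> = (\<lambda>(\<delta>, C). ((comm_sign C A * \<epsilon>\<^sub>1, A), (comm_sign C B * \<epsilon>\<^sub>2, B))) `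
      ({1, -1 :: int} \<times> Pow {1..n})"
    by (rule image_cong) (auto simp: act)
  finally show ?thesis
    by force
qed

theorem theorem4p1:
  fixes n :: nat and A B :: "nat set" and \<epsilon>\<^sub>1 \<epsilon>\<^sub>2 :: int
  assumes "n \<ge> 1"
    and "A \<subseteq> {1..n}" and "B \<subseteq> {1..n}"
    and "\<epsilon>\<^sub>1 \<in> {1, -1}" and "\<epsilon>\<^sub>2 \<in> {1, -1}"
  shows
    "clifford_orbit n (\<epsilon>\<^sub>1, {}) (\<epsilon>\<^sub>2, {}) = {((\<epsilon>\<^sub>1, {}), (\<epsilon>\<^sub>2, {}))} \<and>
     (A \<noteq> B \<and> A \<noteq> {} \<and> A \<noteq> {1..n} \<and> B \<noteq> {} \<and> B \<noteq> {1..n} \<longrightarrow>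
       clifford_orbit n (\<epsilon>\<^sub>1, A) (\<epsilon>\<^sub>2, B) =
         (if odd n \<and> A \<union> B = {1..n} \<and> A \<inter> B = {}
          then {((\<epsilon>\<^sub>1, A), (\<epsilon>\<^sub>2, B)), ((-\<epsilon>\<^sub>1, A), (-\<epsilon>\<^sub>2, B))}
          else {((1, A), (1, B)), ((-1, A), (-1, B)), ((-1, A), (1, B)), ((1, A), (-1, B))})) \<and>
     (A \<noteq> {} \<longrightarrow>
       clifford_orbit n (\<epsilon>\<^sub>1, {}) (\<epsilon>\<^sub>2, A) =
         (if odd n \<and> A = {1..n}
          then {((\<epsilon>\<^sub>1, {}), (\<epsilon>\<^sub>2, {1..n}))}
          else {((\<epsilon>\<^sub>1, {}), (\<epsilon>\<^sub>2, A)), ((\<epsilon>\<^sub>1, {}), (-\<epsilon>\<^sub>2, A))}) \<and>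
       clifford_orbit n (\<epsilon>\<^sub>1, A) (\<epsilon>\<^sub>2, {}) =
         (if odd n \<and> A = {1..n}
          then {((\<epsilon>\<^sub>1, {1..n}), (\<epsilon>\<^sub>2, {}))}
          else {((\<epsilon>\<^sub>1, A), (\<epsilon>\<^sub>2, {})), ((-\<epsilon>\<^sub>1, A), (\<epsilon>\<^sub>2, {}))})) \<and>
     (A \<noteq> {} \<longrightarrow>
       clifford_orbit n (\<epsilon>\<^sub>1, A) (\<epsilon>\<^sub>2, A) =
         (if odd n \<and> A = {1..n}
          then {((\<epsilon>\<^sub>1, {1..n}), (\<epsilon>\<^sub>2, {1..n}))}
          else {((\<epsilon>\<^sub>1, A), (\<epsilon>\<^sub>2, A)), ((-\<epsilon>\<^sub>1, A), (-\<epsilon>\<^sub>2, A))}))"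
proof -
  let ?X = "{1..n}"
  note orb = clifford_orbit_eq[OF assms(4) _ assms(5)]
  have a: "clifford_orbit n (\<epsilon>\<^sub>1, {}) (\<epsilon>\<^sub>2, {}) = {((\<epsilon>\<^sub>1, {}), (\<epsilon>\<^sub>2, {}))}"
    by (simp add: orb image_constant_conv Pow_not_empty)
  have one: "clifford_orbit n (\<epsilon>\<^sub>1, {}) (\<epsilon>\<^sub>2, A) =
        (\<lambda>s. ((\<epsilon>\<^sub>1, {}), (s * \<epsilon>\<^sub>2, A))) ` (\<lambda>C. comm_sign C A) ` Pow ?X"
      "clifford_orbit n (\<epsilon>\<^sub>1, A) (\<epsilon>\<^sub>2, {}) =
        (\<lambda>s. ((s * \<epsilon>\<^sub>1, A), (\<epsilon>\<^sub>2, {}))) ` (\<lambda>C. comm_sign C A) ` Pow ?X"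
      "clifford_orbit n (\<epsilon>\<^sub>1, A) (\<epsilon>\<^sub>2, A) =
        (\<lambda>s. ((s * \<epsilon>\<^sub>1, A), (s * \<epsilon>\<^sub>2, A))) ` (\<lambda>C. comm_sign C A) ` Pow ?X"
    using assms(2) by (simp_all only: orb image_image empty_subsetI comm_sign_empty mult_1_left prod.case)
  have b: "clifford_orbit n (\<epsilon>\<^sub>1, A) (\<epsilon>\<^sub>2, B) =
      (if odd n \<and> A \<union> B = ?X \<and> A \<inter> B = {}
       then {((\<epsilon>\<^sub>1, A), (\<epsilon>\<^sub>2, B)), ((-\<epsilon>\<^sub>1, A), (-\<epsilon>\<^sub>2, B))}
       else {((1, A), (1, B)), ((-1, A), (-1, B)), ((-1, A), (1, B)), ((1, A), (-1, B))})"
    if ne: "A \<noteq> B" "A \<noteq> {}" "A \<noteq> ?X" "B \<noteq> {}" "B \<noteq> ?X"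
  proof (cases "odd n \<and> A \<union> B = ?X \<and> A \<inter> B = {}")
    case True
    then have X: "sym_diff A B = ?X"
      by auto
    have agree: "comm_sign C B = comm_sign C A" if C: "C \<in> Pow ?X" for C
    proof -
      have "finite A" "finite B" "finite C"
        using assms(2,3) C by (auto intro: finite_subset)
      then have "comm_sign C A * comm_sign C B = comm_sign C ?X"
        using comm_sign_sym_diff_right[of C A B] X by simp
      also have "\<dots> = 1"
        using comm_sign_full[of n C] True C by simp
      finally show ?thesis
        using comm_sign_cases[of C A] by auto
    qed
    have "clifford_orbit n (\<epsilon>\<^sub>1, A) (\<epsilon>\<^sub>2, B) =
        (\<lambda>s. ((s * \<epsilon>\<^sub>1, A), (s * \<epsilon>\<^sub>2, B))) ` (\<lambda>C. comm_sign C A) ` Pow ?X"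
      unfolding orb[OF assms(2,3)] image_image by (intro image_cong) (simp_all only: agree prod.case)
    then show ?thesis
      unfolding range_comm_sign[OF assms(2)] using True ne by simp
  next
    case False
    have "\<not> (odd n \<and> sym_diff A B = ?X)"
    proof
      assume h: "odd n \<and> sym_diff A B = ?X"
      then have "A \<union> B = ?X" "A \<inter> B = {}"
        using assms(2,3) by blast+
      with h False show False by simp
    qed
    then have "(\<lambda>C. (comm_sign C A, comm_sign C B)) ` Pow ?X = {1, -1} \<times> {1, -1}"
      using ne assms(2,3) by (intro range_comm_sign_pair) simp_all
    then have "clifford_orbit n (\<epsilon>\<^sub>1, A) (\<epsilon>\<^sub>2, B) =
        (\<lambda>(s, t). ((s * \<epsilon>\<^sub>1, A), (t * \<epsilon>\<^sub>2, B))) ` ({1, -1} \<times> {1, -1})"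
      unfolding orb[OF assms(2,3)] by (rule arg_cong)
    then show ?thesis
      unfolding if_not_P[OF False] using assms(4,5) by (elim insertE emptyE) auto
  qed
  show ?thesis
    using a b unfolding one range_comm_sign[OF assms(2)] by simp
qed

end
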